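(* Consider the sharded Bayesian additive regression trees (SBT) model with sharding tree $\mathcal{T}_u$ of depth $k$ (so at most $2^k$ leaf nodes), fitted to $n$ samples. Assume that the BART model attached to the $j$-th leaf of $\mathcal{T}_u$ consists of $m_j$ single trees, each fitted with at most $n_j$ samples. Then the worst-case computational complexity of each MCMC step in SBT is $$\mathcal{O}\Big(n^2+\sum_{j=1}^{2^k}m_j^2n_j^2\Big).$$ Specifically, when the auxiliary variable is uniform, so that the shards have equal size (in expectation) $n_j=n/2^k$, and the same number $m_j=m$ of trees is used in each BART, this complexity becomes $\mathcal{O}\big(n^2+m^2n^2/2^k\big)$, which tends to $\mathcal{O}(n^2)$ as $k\to\infty$.
   Context: SBT: each of the $n$ observations $(\bm{x}_i,y_i)$ is augmented with an auxiliary variable $u_i\in[0,1]$. A binary tree $\mathcal{T}_u$ splitting only on $u$ partitions $[0,1]$ and thereby the data into shards, one per leaf. To each leaf $j$ a BART model (a sum of $m_j$ binary regression trees splitting on $\bm{x}$) is attached and fitted to the shard of that leaf only. One MCMC step of SBT: (a) propose a new $\mathcal{T}_u$ and accept or reject it by a Metropolis--Hastings step; (b) for each leaf $j$ of $\mathcal{T}_u$, perform one MCMC step of the $j$-th BART on its shard. The update of $\mathcal{T}_u$ is accounted for as the update of a single tree ($m=1$) with $n$ samples. One MCMC step of a BART with $m$ trees on $N$ samples: for each of the $m$ trees in turn, propose a new tree structure by one of four moves (grow two children at a leaf; prune two sibling leaves; swap the splitting rules of two interior nodes; change the splitting rule of one interior node), and accept or reject it by a Metropolis--Hastings ratio whose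 numerator and denominator have the form $\prod_{j=1}^m\big(\prod_{\eta\text{ leaf of }\mathcal{T}_j}\ell(\mu_\eta\mid\bm{X},\bm{y})\big)p(\mathcal{T}_j)$. Cost model: a structural move on a tree with $k_i$ nodes costs $\mathcal{O}(k_i)$; each leaf likelihood factor $\ell$ costs $\mathcal{O}(N)$; every leaf contains at least one sample, so that a tree has at most $N$ leaves. *)

theory Defs
  imports "HOL-Probability.Probability" "HOL-Library.Tree" "HOL-Library.Landau_Symbols"
begin

section \<open>Trees and the partitions they induce\<close>

text \<open>
  A tree structure is a binary tree from \<^theory>\<open>HOL-Library.Tree\<close> whose interior nodes carry
  splitting rules; its depth is \<^const>\<open>height\<close> and its number of leaves is \<^const>\<open>size1\<close>.
  \<open>leaf_cells goes_left T A\<close> lists, from left to right, the part of \<open>A\<close> that is routed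
  to each leaf of \<open>T\<close>.
\<close>

fun leaf_cells :: "('r \<Rightarrow> 'i \<Rightarrow> bool) \<Rightarrow> 'r tree \<Rightarrow> 'i set \<Rightarrow> 'i set list" where
  "leaf_cells goes_left Leaf A = [A]"
| "leaf_cells goes_left (Node l r t) A =
     leaf_cells goes_left l {i \<in> A. goes_left r i} @ leaf_cells goes_left t {i \<in> A. \<not> goes_left r i}"

definition occupied :: "('r \<Rightarrow> 'i \<Rightarrow> bool) \<Rightarrow> 'r tree \<Rightarrow> 'i set \<Rightarrow> bool" where
  "occupied goes_left T A \<longleftrightarrow> (\<forall>S \<in> set (leaf_cells goes_left T A). S \<noteq> {})"

definition nodes :: "'r tree \<Rightarrow> nat" where
  "nodes T = size T + size1 T"


section \<open>Structural moves\<close>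

inductive grow :: "'r tree \<Rightarrow> 'r tree \<Rightarrow> bool" where
  "grow Leaf (Node Leaf r Leaf)"
| "grow l l' \<Longrightarrow> grow (Node l r t) (Node l' r t)"
| "grow t t' \<Longrightarrow> grow (Node l r t) (Node l r t')"

definition prune :: "'r tree \<Rightarrow> 'r tree \<Rightarrow> bool" where
  "prune T T' \<longleftrightarrow> grow T' T"

text \<open>
  The remaining two moves keep the shape. A tree is determined by its shape and the in-order list
  of its rules, so both moves are described by their effect on that list.
\<close>

definition same_shape :: "'r tree \<Rightarrow> 'r tree \<Rightarrow> bool" where
  "same_shape T T' \<longleftrightarrow> map_tree (\<lambda>_. ()) T = map_tree (\<lambda>_. ()) T'"

definition swap_rules :: "'r tree \<Rightarrow> 'r tree \<Rightarrow> bool" where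
  "swap_rules T T' \<longleftrightarrow> same_shape T T' \<and>
     (\<exists>a b. a < size T \<and> b < size T \<and> a \<noteq> b \<and>
        inorder T' = (inorder T)[a := inorder T ! b, b := inorder T ! a])"

definition change_rule :: "'r tree \<Rightarrow> 'r tree \<Rightarrow> bool" where
  "change_rule T T' \<longleftrightarrow> same_shape T T' \<and>
     (\<exists>a r. a < size T \<and> inorder T' = (inorder T)[a := r])"

definition proposal :: "'r tree \<Rightarrow> 'r tree \<Rightarrow> bool" where
  "proposal T T' \<longleftrightarrow> grow T T' \<or> prune T T' \<or> swap_rules T T' \<or> change_rule T T'"


section \<open>Cost model\<close>

text \<open>
  Worst-case operation counts: \<open>move_cost\<close> of a structural move, as a function of the number of
  nodes of the tree; \<open>lik_cost\<close> of one leaf likelihood factor, as a function of the number of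
  samples; \<open>prior_cost\<close> of one evaluation of the tree prior, as a function of the number of nodes.
  Nothing is charged for the prior if \<open>prior_cost\<close> is zero.
\<close>

record cost_model =
  move_cost :: "nat \<Rightarrow> nat"
  lik_cost :: "nat \<Rightarrow> nat"
  prior_cost :: "nat \<Rightarrow> nat"

text \<open>
  Cost of evaluating the product, over all trees of the ensemble, of all leaf likelihoods and the
  tree prior; the numerator and the denominator of the Metropolis-Hastings ratio are both of
  this form, for the proposed and for the current ensemble.
\<close>

definition product_cost :: "cost_model \<Rightarrow> nat \<Rightarrow> 'r tree list \<Rightarrow> nat" where
  "product_cost cm N Ts = (\<Sum>T\<leftarrow>Ts. size1 T * lik_cost cm N + prior_cost cm (nodes T))"

definition mh_cost :: "cost_model \<Rightarrow> nat \<Rightarrow> 'r tree list \<Rightarrow> nat \<Rightarrow> 'r tree \<Rightarrow> nat" where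
  "mh_cost cm N Ts i T' =
     move_cost cm (nodes (Ts ! i)) + product_cost cm N (Ts[i := T']) + product_cost cm N Ts"


section \<open>One MCMC step of a BART\<close>

text \<open>
  A regression tree is a tree structure together with its leaf parameters; a splitting rule on
  covariates of type \<open>'x\<close> is the set of covariate values sent to the left child.
  The covariates are \<open>x :: nat \<Rightarrow> 'x\<close>, and \<open>I\<close> is the index set of the samples fitted.
  Responses enter only through the values of the likelihoods, not through their cost.
\<close>

type_synonym 'x regression_tree = "'x set tree \<times> real list"
type_synonym 'x bart = "'x regression_tree list"

abbreviation (input) route_x :: "(nat \<Rightarrow> 'x) \<Rightarrow> 'x set \<Rightarrow> nat \<Rightarrow> bool" where
  "route_x x \<equiv> (\<lambda>S i. x i \<in> S)"

definition bart_on :: "(nat \<Rightarrow> 'x) \<Rightarrow> nat set \<Rightarrow> 'x bart \<Rightarrow> bool" where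
  "bart_on x I B \<longleftrightarrow> (\<forall>(T, mu) \<in> set B. length mu = size1 T \<and> occupied (route_x x) T I)"

text \<open>
  The outcome of the accept/reject decision is left open, except that a proposal with an empty
  leaf is never accepted. The last argument of each of the following relations is the cost.
\<close>

inductive tree_update ::
  "cost_model \<Rightarrow> (nat \<Rightarrow> 'x) \<Rightarrow> nat set \<Rightarrow> nat \<Rightarrow> 'x bart \<Rightarrow> 'x bart \<Rightarrow> nat \<Rightarrow> bool"
  for cm x I where
  reject: "i < length B \<Longrightarrow> proposal (fst (B ! i)) T' \<Longrightarrow>
     tree_update cm x I i B B (mh_cost cm (card I) (map fst B) i T')"
| accept: "i < length B \<Longrightarrow> proposal (fst (B ! i)) T' \<Longrightarrow>
     occupied (route_x x) T' I \<Longrightarrow> length mu = size1 T' \<Longrightarrow>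
     tree_update cm x I i B (B[i := (T', mu)]) (mh_cost cm (card I) (map fst B) i T')"

inductive tree_updates ::
  "cost_model \<Rightarrow> (nat \<Rightarrow> 'x) \<Rightarrow> nat set \<Rightarrow> nat list \<Rightarrow> 'x bart \<Rightarrow> 'x bart \<Rightarrow> nat \<Rightarrow> bool"
  for cm x I where
  finished: "tree_updates cm x I [] B B 0"
| next_tree: "tree_update cm x I i B B' c \<Longrightarrow> tree_updates cm x I js B' B'' c' \<Longrightarrow>
     tree_updates cm x I (i # js) B B'' (c + c')"

definition bart_step ::
  "cost_model \<Rightarrow> (nat \<Rightarrow> 'x) \<Rightarrow> nat set \<Rightarrow> 'x bart \<Rightarrow> 'x bart \<Rightarrow> nat \<Rightarrow> bool" where
  "bart_step cm x I B B' c \<longleftrightarrow> tree_updates cm x I [0..<length B] B B' c"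


section \<open>One MCMC step of SBT\<close>

text \<open>
  The sharding tree splits on \<open>u\<close> at cutpoints. An SBT state consists of the sharding tree
  and the BARTs attached to its leaves, listed from left to right.
\<close>

type_synonym 'x sbt = "real tree \<times> 'x bart list"

definition cells :: "real tree \<Rightarrow> real set list" where
  "cells T = leaf_cells (\<lambda>c v. v \<le> c) T {0..1}"

definition shards :: "nat \<Rightarrow> (nat \<Rightarrow> real) \<Rightarrow> real tree \<Rightarrow> nat set list" where
  "shards n u T = leaf_cells (\<lambda>c i. u i \<le> c) T {..<n}"

definition sbt_state :: "nat \<Rightarrow> (nat \<Rightarrow> real) \<Rightarrow> (nat \<Rightarrow> 'x) \<Rightarrow> 'x sbt \<Rightarrow> bool" where
  "sbt_state n u x = (\<lambda>(T, Bs).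
     occupied (\<lambda>c i. u i \<le> c) T {..<n} \<and> length Bs = size1 T \<and>
     (\<forall>j < size1 T. bart_on x (shards n u T ! j) (Bs ! j)))"

text \<open>
  When a new sharding tree is accepted, the shards change; the BARTs attached to its leaves may
  then be any that are admissible on the new shards.
\<close>

inductive sharding_update ::
  "cost_model \<Rightarrow> nat \<Rightarrow> (nat \<Rightarrow> real) \<Rightarrow> (nat \<Rightarrow> 'x) \<Rightarrow> 'x sbt \<Rightarrow> 'x sbt \<Rightarrow> nat \<Rightarrow> bool"
  for cm n u x where
  reject: "proposal T T' \<Longrightarrow>
     sharding_update cm n u x (T, Bs) (T, Bs) (mh_cost cm n [T] 0 T')"
| accept: "proposal T T' \<Longrightarrow> sbt_state n u x (T', Bs') \<Longrightarrow>
     sharding_update cm n u x (T, Bs) (T', Bs') (mh_cost cm n [T] 0 T')"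

definition bart_steps ::
  "cost_model \<Rightarrow> nat \<Rightarrow> (nat \<Rightarrow> real) \<Rightarrow> (nat \<Rightarrow> 'x) \<Rightarrow> 'x sbt \<Rightarrow> 'x sbt \<Rightarrow> nat \<Rightarrow> bool" where
  "bart_steps cm n u x = (\<lambda>(T, Bs) (T', Bs') c.
     T' = T \<and> length Bs' = length Bs \<and>
     (\<exists>cost. (\<forall>j < size1 T. bart_step cm x (shards n u T ! j) (Bs ! j) (Bs' ! j) (cost j)) \<and>
             c = (\<Sum>j < size1 T. cost j)))"

text \<open>
  Worst-case cost of an MCMC step for the data \<open>n, u, x\<close>, over all initial states and all executions.
  The constraint \<open>Q\<close> is on the state reached after the update of the sharding tree, that is,
  on the sharding tree and the BARTs that the second part of the step works with.
\<close>

definition sbt_worst_case ::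
  "cost_model \<Rightarrow> nat \<Rightarrow> (nat \<Rightarrow> real) \<Rightarrow> (nat \<Rightarrow> 'x) \<Rightarrow> ('x sbt \<Rightarrow> bool) \<Rightarrow> ennreal" where
  "sbt_worst_case cm n u x Q =
     Sup {ennreal (real (c1 + c2)) | c1 c2. \<exists>s s' s''.
            sbt_state n u x s \<and> sharding_update cm n u x s s' c1 \<and> Q s' \<and>
            bart_steps cm n u x s' s'' c2}"

definition has_sizes ::
  "nat \<Rightarrow> (nat \<Rightarrow> real) \<Rightarrow> nat \<Rightarrow> (nat \<Rightarrow> nat) \<Rightarrow> (nat \<Rightarrow> real) \<Rightarrow> 'x sbt \<Rightarrow> bool" where
  "has_sizes n u k m N = (\<lambda>(T, Bs). height T = k \<and>
     (\<forall>j < size1 T. length (Bs ! j) = m j \<and> real (card (shards n u T ! j)) \<le> N j))"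


section \<open>Uniform auxiliary variable\<close>

definition uniform_aux :: "'w measure \<Rightarrow> nat \<Rightarrow> (nat \<Rightarrow> 'w \<Rightarrow> real) \<Rightarrow> bool" where
  "uniform_aux M n U \<longleftrightarrow> prob_space M \<and> prob_space.indep_vars M (\<lambda>_. borel) U {..<n} \<and>
     (\<forall>i < n. distr M borel (U i) = uniform_measure lborel {0..1})"

text \<open>
  For uniform \<open>u\<close> the shards have equal expected size precisely when the cells of the sharding
  tree have equal length.
\<close>

definition equal_cells :: "nat \<Rightarrow> real tree \<Rightarrow> bool" where
  "equal_cells k T \<longleftrightarrow> height T = k \<and> (\<forall>S \<in> set (cells T). measure lborel S = 1 / 2 ^ k)"

end

theory Submission
  imports Defs "HOL-Real_Asymp.Real_Asymp"
begin

text \<open>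
  Occupied trees have at most as many leaves as there are samples, and a proposal adds at most one
  leaf, so each leaf product over \<open>m\<close> trees on \<open>N\<close> samples costs \<open>O(m N\<^sup>2)\<close>; a BART step
  evaluates it \<open>O(m)\<close> times. For uniform auxiliary variables with equal cells the size of a shard is
  binomial with success probability \<open>p = 1 / 2 ^ k\<close>, and its second moment is at most
  \<open>n p + (n p)\<^sup>2\<close>. Summed over the \<open>L \<le> 2 ^ k\<close> leaves, the variance part \<open>L n p\<close> is absorbed
  because an empty shard is never admitted: \<open>L \<le> n\<close> whenever some state exists.
\<close>

section \<open>Leaves and proposals\<close>

lemma length_leaf_cells [simp]: "length (leaf_cells g T A) = size1 T"
  by (induction T arbitrary: A) auto

text \<open>A split divides the samples into two disjoint parts, so cardinalities add just as leaf
  counts do, and each leaf uses up at least one sample. This turns the absence of empty leaves into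
  a bound on the size of a tree.\<close>

lemma size1_le_card_if_occupied:
  assumes "finite A" "occupied g T A"
  shows "size1 T \<le> card A"
  using assms
proof (induction T arbitrary: A)
  case Leaf
  then show ?case by (auto simp: occupied_def Suc_le_eq card_gt_0_iff)
next
  case (Node l r t)
  have "card A = card {i \<in> A. g r i} + card {i \<in> A. \<not> g r i}"
    using Node.prems(1) by (subst card_Un_disjoint [symmetric]) (auto intro: arg_cong [of _ _ card])
  moreover have "size1 l \<le> card {i \<in> A. g r i}" "size1 t \<le> card {i \<in> A. \<not> g r i}"
    using Node.prems by (auto intro!: Node.IH simp: occupied_def)
  ultimately show ?case by simp
qed

text \<open>Routing commutes with preimages. With \<open>f\<close> the auxiliary variable, each
  shard becomes the preimage of a set of reals determined by the tree alone; with \<open>f\<close>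
  the identity, the cells in the unit interval become traces of the same sets.\<close>

lemma leaf_cells_vimage:
  "leaf_cells (\<lambda>r i. g r (f i)) T {i \<in> A. f i \<in> B} = map (\<lambda>S. {i \<in> A. f i \<in> S}) (leaf_cells g T B)"
proof (induction T arbitrary: B)
  case Leaf
  show ?case by simp
next
  case (Node l r t)
  have "{i \<in> {i \<in> A. f i \<in> B}. g r (f i)} = {i \<in> A. f i \<in> {v \<in> B. g r v}}"
    "{i \<in> {i \<in> A. f i \<in> B}. \<not> g r (f i)} = {i \<in> A. f i \<in> {v \<in> B. \<not> g r v}}"
    by auto
  then show ?case
    by (simp only: leaf_cells.simps Node.IH map_append)
qed

lemma grow_size1: "grow T T' \<Longrightarrow> size1 T' = Suc (size1 T)"
  by (induction rule: grow.induct) auto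

lemma same_shape_size1: "same_shape T T' \<Longrightarrow> size1 T' = size1 T"
  unfolding same_shape_def by (metis size1_map_tree)

lemma proposal_size1: "proposal T T' \<Longrightarrow> size1 T' \<le> Suc (size1 T)"
  by (auto simp: proposal_def prune_def swap_rules_def change_rule_def
      dest!: grow_size1 same_shape_size1)

lemma nodes_bounds: "1 \<le> nodes T" "nodes T \<le> 2 * size1 T"
  by (auto simp: nodes_def size1_size)


section \<open>Cost of one step\<close>

text \<open>Only finitely many arguments escape the eventual bound, and adding all their values to
  the constant covers them. The restriction to \<open>1 \<le> a\<close> is essential, since a linear
  bound at 0 would force \<open>f 0 = 0\<close>.\<close>

lemma bigo_linear_bound:
  assumes "(\<lambda>a. real (f a)) \<in> O(\<lambda>a. real a)"
  obtains D where "D > 0" "\<And>a. 1 \<le> a \<Longrightarrow> real (f a) \<le> D * real a"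
proof -
  from assms obtain c where c: "c > 0" "eventually (\<lambda>a. norm (real (f a)) \<le> c * norm (real a)) at_top"
    by (rule landau_o.bigE)
  then obtain b where b: "\<And>a. a \<ge> b \<Longrightarrow> real (f a) \<le> c * real a"
    by (auto simp: eventually_at_top_linorder)
  let ?D = "c + (\<Sum>i<b. real (f i))"
  have "real (f a) \<le> ?D * real a" if "1 \<le> a" for a
  proof (cases "a < b")
    case True
    have "real (f a) \<le> (\<Sum>i<b. real (f i))"
      using True by (intro member_le_sum) auto
    also have "\<dots> \<le> ?D * 1" using c by simp
    also have "\<dots> \<le> ?D * real a"
      using that c by (intro mult_left_mono) (auto intro!: add_nonneg_nonneg sum_nonneg)
    finally show ?thesis .
  next
    case False
    then have "real (f a) \<le> c * real a" using b by simp
    also have "\<dots> \<le> ?D * real a"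
      by (intro mult_right_mono) (auto intro!: sum_nonneg)
    finally show ?thesis .
  qed
  moreover have "?D > 0" using c by (intro add_pos_nonneg) (auto intro!: sum_nonneg)
  ultimately show ?thesis using that by blast
qed

text \<open>One constant \<open>D\<close> serves all three costs and depends on nothing but the cost
  model, so the bounds derived from it are uniform in the data, the depth and the numbers of
  trees.\<close>

locale linear_cost_model =
  fixes cm :: cost_model and D :: real
  assumes D_pos: "D > 0"
    and move_le: "1 \<le> a \<Longrightarrow> real (move_cost cm a) \<le> D * real a"
    and lik_le: "1 \<le> a \<Longrightarrow> real (lik_cost cm a) \<le> D * real a"
    and prior_le: "1 \<le> a \<Longrightarrow> real (prior_cost cm a) \<le> D * real a"
begin

text \<open>The allowance \<open>Suc N\<close> is for a proposed tree, which may have one leaf too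
  many before the check for empty leaves. The factor 6 is 2 + 4: at most
  \<open>N + 1 \<le> 2 * N\<close> leaves at cost \<open>D * N\<close> each, and a prior on at most
  \<open>4 * N\<close> nodes.\<close>

lemma product_cost_le:
  assumes "1 \<le> N" "\<And>T. T \<in> set Ts \<Longrightarrow> size1 T \<le> Suc N"
  shows "real (product_cost cm N Ts) \<le> 6 * D * real (length Ts) * (real N)\<^sup>2"
  using assms(2)
proof (induction Ts)
  case Nil
  show ?case by (simp add: product_cost_def)
next
  case (Cons T Ts)
  have N: "real N \<le> (real N)\<^sup>2" using assms(1) by (simp add: self_le_power)
  have s: "real (size1 T) \<le> 2 * real N" using Cons.prems [of T] assms(1) by simp
  have "real (size1 T) * real (lik_cost cm N) \<le> (2 * real N) * (D * real N)"
    using s lik_le [OF assms(1)] by (intro mult_mono) auto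
  moreover have "real (prior_cost cm (nodes T)) \<le> D * (4 * (real N)\<^sup>2)"
  proof -
    have "real (nodes T) \<le> 4 * (real N)\<^sup>2" using nodes_bounds(2) [of T] s N by linarith
    then have "D * real (nodes T) \<le> D * (4 * (real N)\<^sup>2)"
      using D_pos by (intro mult_left_mono) auto
    then show ?thesis using prior_le [OF nodes_bounds(1) [of T]] by linarith
  qed
  ultimately show ?case using Cons
    by (simp add: product_cost_def algebra_simps power2_eq_square)
qed

text \<open>The factor 14 is 6 + 6 + 2: the products for the proposed and for the current ensemble,
  and the move on a tree with at most \<open>2 * N\<close> nodes.\<close>

lemma mh_cost_le:
  assumes "1 \<le> N" "\<And>T. T \<in> set Ts \<Longrightarrow> size1 T \<le> N" "i < length Ts" "proposal (Ts ! i) T'"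
  shows "real (mh_cost cm N Ts i T') \<le> 14 * D * real (length Ts) * (real N)\<^sup>2"
proof -
  have si: "size1 (Ts ! i) \<le> N" using assms by simp
  have "size1 T' \<le> Suc N" using si proposal_size1 [OF assms(4)] by linarith
  then have "size1 T \<le> Suc N" if "T \<in> set (Ts[i := T'])" for T
    using that assms(2) set_update_subset_insert [of Ts i T'] by (fastforce intro: le_SucI)
  then have "real (product_cost cm N (Ts[i := T'])) \<le> 6 * D * real (length (Ts[i := T'])) * (real N)\<^sup>2"
    using assms(1) by (intro product_cost_le) auto
  moreover have "real (product_cost cm N Ts) \<le> 6 * D * real (length Ts) * (real N)\<^sup>2"
    using assms by (intro product_cost_le) (auto intro: le_SucI)
  moreover have "real (move_cost cm (nodes (Ts ! i))) \<le> 2 * D * real (length Ts) * (real N)\<^sup>2"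
  proof -
    have "real N \<le> (real N)\<^sup>2" using assms(1) by (simp add: self_le_power)
    \<comment> \<open>The index \<open>i\<close> shows that the ensemble is nonempty, so the cost of
      the move fits under the same product as the likelihoods.\<close>
    also have "\<dots> \<le> real (length Ts) * (real N)\<^sup>2"
      using assms(3) by (auto simp: mult_le_cancel_right1)
    finally have "real (nodes (Ts ! i)) \<le> 2 * (real (length Ts) * (real N)\<^sup>2)"
      using nodes_bounds(2) [of "Ts ! i"] si by linarith
    then have "D * real (nodes (Ts ! i)) \<le> D * (2 * (real (length Ts) * (real N)\<^sup>2))"
      using D_pos by (intro mult_left_mono) auto
    then show ?thesis using move_le [OF nodes_bounds(1) [of "Ts ! i"]] by linarith
  qed
  ultimately show ?thesis by (simp add: mh_cost_def)
qed

lemma bart_on_size1: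
  assumes "bart_on x I B" "finite I" "T \<in> set (map fst B)"
  shows "size1 T \<le> card I"
  using assms by (auto simp: bart_on_def intro!: size1_le_card_if_occupied)

text \<open>The cost bound rests on occupancy of the current ensemble only. Acceptance requires
  occupancy of the new tree, so the same bound is available again for the next update.\<close>

lemma tree_update_invariant:
  assumes "tree_update cm x I i B B' c" "bart_on x I B" "finite I" "I \<noteq> {}"
  shows "bart_on x I B'" "length B' = length B"
    "real c \<le> 14 * D * real (length B) * (real (card I))\<^sup>2"
proof -
  have I: "1 \<le> card I" using assms by (simp add: Suc_le_eq card_gt_0_iff)
  have cost: "real (mh_cost cm (card I) (map fst B) i T') \<le> 14 * D * real (length B) * (real (card I))\<^sup>2"
    if "i < length B" "proposal (fst (B ! i)) T'" for T'
  proof -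
    have "real (mh_cost cm (card I) (map fst B) i T')
        \<le> 14 * D * real (length (map fst B)) * (real (card I))\<^sup>2"
      using I that bart_on_size1 [OF assms(2,3)] by (intro mh_cost_le) auto
    then show ?thesis by simp
  qed
  show "bart_on x I B'"
    using assms(1)
  proof cases
    case (accept T' mu)
    have "set B' \<subseteq> insert (T', mu) (set B)"
      using accept by (simp add: set_update_subset_insert)
    then show ?thesis using accept assms(2) unfolding bart_on_def by auto
  qed (use assms in simp)
  show "length B' = length B" "real c \<le> 14 * D * real (length B) * (real (card I))\<^sup>2"
    using assms(1) cost by (auto elim!: tree_update.cases)
qed

text \<open>The number of updates and the number of trees are separate factors because the induction
  consumes \<open>js\<close> while the ensemble keeps its length. In a full sweep both equal the
  number of trees, which is the origin of its square.\<close>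

lemma tree_updates_cost_le:
  assumes "tree_updates cm x I js B B' c" "bart_on x I B" "finite I" "I \<noteq> {}"
  shows "real c \<le> 14 * D * real (length js) * real (length B) * (real (card I))\<^sup>2"
  using assms
proof (induction rule: tree_updates.induct)
  case (next_tree i B B' c js B'' c')
  then show ?case
    using tree_update_invariant [OF next_tree.hyps(1) next_tree.prems]
    by (simp add: algebra_simps)
qed simp

lemma bart_step_cost_le:
  assumes "bart_step cm x I B B' c" "bart_on x I B" "finite I" "I \<noteq> {}"
  shows "real c \<le> 14 * D * ((real (length B))\<^sup>2 * (real (card I))\<^sup>2)"
  using tree_updates_cost_le [of x I "[0..<length B]" B B' c] assms
  by (simp add: bart_step_def power2_eq_square mult.assoc)

end

section \<open>From a single BART to the whole SBT step\<close>

lemma shards_nth: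
  assumes "j < size1 T"
  shows "shards n u T ! j = {i \<in> {..<n}. u i \<in> leaf_cells (\<lambda>c v. v \<le> c) T UNIV ! j}"
proof -
  have "{i \<in> {..<n}. u i \<in> UNIV} = {..<n}" by auto
  then have "shards n u T = map (\<lambda>S. {i \<in> {..<n}. u i \<in> S}) (leaf_cells (\<lambda>c v. v \<le> c) T UNIV)"
    using leaf_cells_vimage [of "\<lambda>c v. v \<le> c" u T "{..<n}" UNIV] unfolding shards_def by (simp only:)
  then show ?thesis using assms by (simp only: nth_map length_leaf_cells)
qed

lemma sbt_state_shard:
  assumes "sbt_state n u x (T, Bs)" "j < size1 T"
  shows "finite (shards n u T ! j)" "shards n u T ! j \<noteq> {}" "bart_on x (shards n u T ! j) (Bs ! j)"
proof -
  show "finite (shards n u T ! j)" unfolding shards_nth [OF assms(2)] by simp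
  have "occupied (\<lambda>c i. u i \<le> c) T {..<n}" using assms(1) by (simp add: sbt_state_def)
  moreover have "shards n u T ! j \<in> set (leaf_cells (\<lambda>c i. u i \<le> c) T {..<n})"
    unfolding shards_def using assms(2) by (intro nth_mem) simp
  ultimately show "shards n u T ! j \<noteq> {}" unfolding occupied_def by (rule bspec)
  show "bart_on x (shards n u T ! j) (Bs ! j)" using assms by (simp add: sbt_state_def)
qed

lemma sbt_state_size1:
  assumes "sbt_state n u x (T, Bs)"
  shows "size1 T \<le> n"
proof -
  have "occupied (\<lambda>c i. u i \<le> c) T {..<n}" using assms by (simp add: sbt_state_def)
  from size1_le_card_if_occupied [OF _ this] show ?thesis by simp
qed

text \<open>Stated with the actual shard sizes of one state, so that prescribed size bounds and
  random shard sizes can both be inserted later.\<close>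

definition size_bound :: "nat \<Rightarrow> (nat \<Rightarrow> real) \<Rightarrow> 'x sbt \<Rightarrow> real" where
  "size_bound n u = (\<lambda>(T, Bs). (real n)\<^sup>2 +
     (\<Sum>j<size1 T. (real (length (Bs ! j)))\<^sup>2 * (real (card (shards n u T ! j)))\<^sup>2))"

context linear_cost_model
begin

text \<open>The sharding tree is an ensemble of length one on \<open>n\<close> samples. Having a
  state at all gives \<open>1 \<le> n\<close>, because every tree has a leaf and every leaf holds a
  sample.\<close>

lemma sharding_update_cost_le:
  assumes "sbt_state n u x s" "sharding_update cm n u x s s' c"
  shows "sbt_state n u x s'" "real c \<le> 14 * D * (real n)\<^sup>2"
proof -
  show "sbt_state n u x s'" using assms by (auto elim: sharding_update.cases)
  obtain T Bs T' where T: "s = (T, Bs)" "proposal T T'" "c = mh_cost cm n [T] 0 T'"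
    using assms(2) by (auto elim: sharding_update.cases)
  have "size1 T \<le> n" using assms(1) unfolding T(1) by (rule sbt_state_size1)
  moreover from this have "1 \<le> n" by (simp add: size1_size)
  ultimately have "real (mh_cost cm n [T] 0 T') \<le> 14 * D * real (length [T]) * (real n)\<^sup>2"
    using T(2) by (intro mh_cost_le) auto
  then show "real c \<le> 14 * D * (real n)\<^sup>2" unfolding T(3) by simp
qed

lemma bart_steps_cost_le:
  assumes "sbt_state n u x (T, Bs)" "bart_steps cm n u x (T, Bs) s'' c"
  shows "real c \<le> 14 * D *
    (\<Sum>j<size1 T. (real (length (Bs ! j)))\<^sup>2 * (real (card (shards n u T ! j)))\<^sup>2)"
proof -
  obtain Bs' cost where
    "\<And>j. j < size1 T \<Longrightarrow> bart_step cm x (shards n u T ! j) (Bs ! j) (Bs' ! j) (cost j)"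
    and c: "c = (\<Sum>j<size1 T. cost j)"
    using assms(2) by (auto simp: bart_steps_def split: prod.splits)
  then have "real (cost j) \<le> 14 * D * ((real (length (Bs ! j)))\<^sup>2 * (real (card (shards n u T ! j)))\<^sup>2)"
    if "j < size1 T" for j
    using that sbt_state_shard [OF assms(1)] by (intro bart_step_cost_le) auto
  then show ?thesis unfolding c of_nat_sum sum_distrib_left by (intro sum_mono) simp
qed

text \<open>\<open>Q\<close> speaks of the state after the sharding update, where the BART costs
  arise. The sharding cost arises from the initial state, but its bound involves \<open>n\<close>
  only, so control of the later state suffices.\<close>

lemma sbt_worst_case_le:
  assumes "\<And>T Bs. sbt_state n u x (T, Bs) \<Longrightarrow> Q (T, Bs) \<Longrightarrow> size_bound n u (T, Bs) \<le> b"
  shows "sbt_worst_case cm n u x Q \<le> ennreal (14 * D * b)"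
  unfolding sbt_worst_case_def
proof (rule Sup_least, clarify)
  fix c1 c2 :: nat and T Bs T1 Bs1 T2 Bs2
  assume "sbt_state n u x (T, Bs)" "sharding_update cm n u x (T, Bs) (T1, Bs1) c1"
    and Q: "Q (T1, Bs1)" and steps: "bart_steps cm n u x (T1, Bs1) (T2, Bs2) c2"
  then have s1: "sbt_state n u x (T1, Bs1)" and c1: "real c1 \<le> 14 * D * (real n)\<^sup>2"
    using sharding_update_cost_le by blast+
  have "real (c1 + c2) \<le> 14 * D * size_bound n u (T1, Bs1)"
    using c1 bart_steps_cost_le [OF s1 steps] by (simp add: size_bound_def algebra_simps)
  also have "\<dots> \<le> 14 * D * b"
    using assms [OF s1 Q] D_pos by (intro mult_left_mono) auto
  finally show "ennreal (real (c1 + c2)) \<le> ennreal (14 * D * b)" by (rule ennreal_leI)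
qed

lemma sbt_worst_case_has_sizes_le:
  "sbt_worst_case cm n u x (has_sizes n u k m N)
     \<le> ennreal (14 * D * ((real n)\<^sup>2 + (\<Sum>j<2 ^ k. (real (m j))\<^sup>2 * (N j)\<^sup>2)))"
proof (rule sbt_worst_case_le)
  fix T :: "real tree" and Bs
  assume Q: "has_sizes n u k m N (T, Bs)"
  then have k: "height T = k" by (simp add: has_sizes_def)
  have j: "length (Bs ! j) = m j" "real (card (shards n u T ! j)) \<le> N j" if "j < size1 T" for j
    using Q that by (auto simp: has_sizes_def)
  have "size1 T \<le> 2 ^ k" using size1_height [of T] unfolding k .
  have "(\<Sum>j<size1 T. (real (length (Bs ! j)))\<^sup>2 * (real (card (shards n u T ! j)))\<^sup>2)
      \<le> (\<Sum>j<size1 T. (real (m j))\<^sup>2 * (N j)\<^sup>2)"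
    using j by (intro sum_mono mult_mono power_mono) auto
  \<comment> \<open>A tree of height \<open>k\<close> need not be complete. The summands added for
    missing leaves are products of squares, hence nonnegative whatever the sign of
    \<open>N j\<close>.\<close>
  also have "\<dots> \<le> (\<Sum>j<2 ^ k. (real (m j))\<^sup>2 * (N j)\<^sup>2)"
    by (rule sum_mono2) (use \<open>size1 T \<le> 2 ^ k\<close> in auto)
  finally show "size_bound n u (T, Bs) \<le> (real n)\<^sup>2 + (\<Sum>j<2 ^ k. (real (m j))\<^sup>2 * (N j)\<^sup>2)"
    by (simp add: size_bound_def)
qed

lemma sbt_worst_case_equal_sizes_le:
  "sbt_worst_case cm n u x (has_sizes n u k (\<lambda>_. m) (\<lambda>_. real n / 2 ^ k))
     \<le> ennreal (14 * D * ((real n)\<^sup>2 + (real m)\<^sup>2 * (real n)\<^sup>2 / 2 ^ k))"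
proof -
  have cancel: "q * (a * (b / q)\<^sup>2) = a * b\<^sup>2 / q" if "q > 0" for a b q :: real
    using that by (simp add: power2_eq_square)
  have "(\<Sum>j<(2::nat) ^ k. (real m)\<^sup>2 * (real n / 2 ^ k)\<^sup>2)
      = 2 ^ k * ((real m)\<^sup>2 * (real n / 2 ^ k)\<^sup>2)"
    by (simp only: sum_constant card_lessThan of_nat_power of_nat_numeral)
  also have "\<dots> = (real m)\<^sup>2 * (real n)\<^sup>2 / 2 ^ k"
    by (rule cancel) simp
  finally show ?thesis
    using sbt_worst_case_has_sizes_le [of n u x k "\<lambda>_. m" "\<lambda>_. real n / 2 ^ k"]
    by (simp only:)
qed

end


section \<open>Uniform auxiliary variable\<close>

text \<open>The count is a sum of indicators, and its square is a double sum of indicators of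
  intersections. Diagonal pairs contribute \<open>p\<close> each and the others
  \<open>p\<^sup>2\<close>; the product formula for pairs enters only the second-moment
  bound.\<close>

lemma (in prob_space)
  fixes V :: "nat \<Rightarrow> 'a set"
  assumes V: "\<And>i. i < n \<Longrightarrow> V i \<in> events" "\<And>i. i < n \<Longrightarrow> prob (V i) = p"
  defines "X \<equiv> (\<lambda>\<omega>. real (card {i \<in> {..<n}. \<omega> \<in> V i}))"
  shows integrable_card_events: "integrable M X"
    and expectation_card_events: "expectation X = real n * p"
    and integrable_card_events_square: "integrable M (\<lambda>\<omega>. (X \<omega>)\<^sup>2)"
    and expectation_card_events_square_le:
      "(\<And>i j. i < n \<Longrightarrow> j < n \<Longrightarrow> i \<noteq> j \<Longrightarrow> prob (V i \<inter> V j) = p\<^sup>2) \<Longrightarrow>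
        expectation (\<lambda>\<omega>. (X \<omega>)\<^sup>2) \<le> real n * p + (real n * p)\<^sup>2"
proof -
  have X: "X = (\<lambda>\<omega>. \<Sum>i<n. indicator (V i) \<omega>)"
    by (simp add: X_def fun_eq_iff indicator_def sum.If_cases Int_def)
  have int: "integrable M (\<lambda>\<omega>. indicator (V i) \<omega> :: real)" if "i < n" for i
    using V that by (simp add: emeasure_eq_measure)
  show "integrable M X" unfolding X using int by (intro Bochner_Integration.integrable_sum) auto
  show "expectation X = real n * p"
    unfolding X using int V by (subst Bochner_Integration.integral_sum) auto
  have X2: "(\<lambda>\<omega>. (X \<omega>)\<^sup>2) = (\<lambda>\<omega>. \<Sum>i<n. \<Sum>j<n. indicator (V i \<inter> V j) \<omega>)"
    by (simp add: X fun_eq_iff power2_eq_square sum_product indicator_inter_arith)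
  have int2: "integrable M (\<lambda>\<omega>. indicator (V i \<inter> V j) \<omega> :: real)" if "i < n" "j < n" for i j
    using V that by (simp add: emeasure_eq_measure)
  show "integrable M (\<lambda>\<omega>. (X \<omega>)\<^sup>2)"
    unfolding X2 using int2 by (intro Bochner_Integration.integrable_sum) auto
  assume indep: "\<And>i j. i < n \<Longrightarrow> j < n \<Longrightarrow> i \<noteq> j \<Longrightarrow> prob (V i \<inter> V j) = p\<^sup>2"
  have "expectation (\<lambda>\<omega>. (X \<omega>)\<^sup>2) = (\<Sum>i<n. expectation (\<lambda>\<omega>. \<Sum>j<n. indicator (V i \<inter> V j) \<omega>))"
    unfolding X2 using int2
    by (intro Bochner_Integration.integral_sum Bochner_Integration.integrable_sum) auto
  also have "\<dots> = (\<Sum>i<n. \<Sum>j<n. expectation (indicator (V i \<inter> V j)))"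
    using int2 by (intro sum.cong refl Bochner_Integration.integral_sum) auto
  also have "\<dots> = (\<Sum>i<n. \<Sum>j<n. prob (V i \<inter> V j))"
    using V by (intro sum.cong refl) auto
  \<comment> \<open>Granting \<open>p\<^sup>2\<close> to the diagonal as well costs little and makes
    the double sum collapse to \<open>(n * p)\<^sup>2\<close> plus the diagonal part.\<close>
  also have "\<dots> \<le> (\<Sum>i<n. \<Sum>j<n. (if i = j then p else 0) + p\<^sup>2)"
    using V indep by (intro sum_mono) (auto split: if_splits)
  also have "\<dots> = real n * p + (real n * p)\<^sup>2"
    by (simp add: sum.distrib power2_eq_square algebra_simps)
  finally show "expectation (\<lambda>\<omega>. (X \<omega>)\<^sup>2) \<le> real n * p + (real n * p)\<^sup>2" .
qed

lemma sets_leaf_cells_borel: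
  assumes "A \<in> sets borel" "S \<in> set (leaf_cells (\<lambda>c v. v \<le> c) (T :: real tree) A)"
  shows "S \<in> sets borel"
  using assms
proof (induction T arbitrary: A)
  case (Node l r t)
  have "{i \<in> A. i \<le> r} = A \<inter> {..r}" "{i \<in> A. \<not> i \<le> r} = A \<inter> {r<..}" by auto
  then have "{i \<in> A. i \<le> r} \<in> sets borel" "{i \<in> A. \<not> i \<le> r} \<in> sets borel"
    using Node.prems(1) by simp_all
  then show ?case
    using Node.IH Node.prems(2) unfolding leaf_cells.simps set_append by blast
qed simp

text \<open>For a tree fixed in advance, a sample belongs to shard \<open>j\<close> exactly when its
  auxiliary variable falls into a fixed Borel set. These are independent events of probability
  \<open>1 / 2 ^ k\<close>, so the moments of a binomial count apply.\<close>

lemma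
  assumes aux: "uniform_aux M n U" and eq: "equal_cells k T" and j: "j < size1 T"
  shows integrable_shard: "integrable M (\<lambda>\<omega>. real (card (shards n (\<lambda>i. U i \<omega>) T ! j)))"
    and expectation_shard: "(LINT \<omega>|M. real (card (shards n (\<lambda>i. U i \<omega>) T ! j))) = real n / 2 ^ k"
    and nn_integral_shard_square_le:
      "(\<integral>\<^sup>+ \<omega>. ennreal ((real (card (shards n (\<lambda>i. U i \<omega>) T ! j)))\<^sup>2) \<partial>M)
         \<le> ennreal (real n / 2 ^ k + (real n / 2 ^ k)\<^sup>2)"
proof -
  interpret prob_space M using aux by (simp add: uniform_aux_def)
  have iv: "indep_vars (\<lambda>_. borel) U {..<n}" using aux by (simp add: uniform_aux_def)
  \<comment> \<open>The cell is taken on the whole line: shards are formed by comparisons with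
    cutpoints alone, and uniformity places \<open>U i\<close> in the unit interval only almost
    surely.\<close>
  define P where "P = leaf_cells (\<lambda>c v. v \<le> c) T UNIV ! j"
  define V where "V i = U i -` P \<inter> space M" for i
  define p :: real where "p = 1 / 2 ^ k"
  have P: "P \<in> sets borel"
  proof (rule sets_leaf_cells_borel)
    show "(UNIV :: real set) \<in> sets borel" by simp
    show "P \<in> set (leaf_cells (\<lambda>c v. v \<le> c) T UNIV)"
      unfolding P_def using j by (intro nth_mem) simp
  qed
  have shard: "shards n u T ! j = {i \<in> {..<n}. u i \<in> P}" for u
    using j unfolding P_def by (rule shards_nth)
  have "{v \<in> {0..1}. v \<in> UNIV} = {0..1 :: real}" by auto
  then have "cells T = map (\<lambda>S. {v \<in> {0..1}. v \<in> S}) (leaf_cells (\<lambda>c v. v \<le> c) T UNIV)"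
    using leaf_cells_vimage [of "\<lambda>c v. v \<le> c" "\<lambda>v. v" T "{0..1}" UNIV]
    unfolding cells_def by (simp only:)
  then have cell: "cells T ! j = {0..1} \<inter> P"
    using j unfolding P_def by (simp only: nth_map length_leaf_cells Int_def mem_Collect_eq)
  have "cells T ! j \<in> set (cells T)"
    unfolding cells_def using j by (intro nth_mem) simp
  then have meas: "measure lborel ({0..1} \<inter> P) = p"
    using eq unfolding equal_cells_def p_def cell [symmetric] by blast
  have U: "U i \<in> borel_measurable M" if "i < n" for i
    using iv that by (simp add: indep_vars_def)
  have V: "V i \<in> events" if "i < n" for i
    using U [OF that] P by (simp add: V_def measurable_sets)
  have prob: "prob (V i) = p" if "i < n" for i
  proof -
    have "prob (V i) = measure (distr M borel (U i)) P"
      using U [OF that] P by (simp add: measure_distr V_def)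
    also have "\<dots> = measure (uniform_measure lborel {0..1 :: real}) P"
      using aux that by (simp add: uniform_aux_def)
    also have "\<dots> = p"
      using P meas by (subst measure_uniform_measure) auto
    finally show ?thesis .
  qed
  have pair: "prob (V i \<inter> V i') = p\<^sup>2" if "i < n" "i' < n" "i \<noteq> i'" for i i'
  proof -
    have "prob (\<Inter>l\<in>{i, i'}. U l -` P \<inter> space M) = (\<Prod>l\<in>{i, i'}. prob (U l -` P \<inter> space M))"
      by (rule indep_varsD [OF iv]) (use that P in simp_all)
    then have "prob (V i \<inter> V i') = prob (V i) * prob (V i')"
      using that(3) unfolding V_def by simp
    then show ?thesis unfolding prob [OF that(1)] prob [OF that(2)] power2_eq_square .
  qed
  \<comment> \<open>Each \<open>V i\<close> is cut down to the sample space, so the two counts agree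
    only there.\<close>
  have card: "real (card (shards n (\<lambda>i. U i \<omega>) T ! j)) = real (card {i \<in> {..<n}. \<omega> \<in> V i})"
    if "\<omega> \<in> space M" for \<omega>
    using that by (simp add: shard V_def)
  have "integrable M (\<lambda>\<omega>. real (card {i \<in> {..<n}. \<omega> \<in> V i}))"
    by (rule integrable_card_events [OF V prob])
  then show "integrable M (\<lambda>\<omega>. real (card (shards n (\<lambda>i. U i \<omega>) T ! j)))"
    by (rule iffD2 [OF Bochner_Integration.integrable_cong [OF refl], rotated]) (rule card)
  have "(LINT \<omega>|M. real (card (shards n (\<lambda>i. U i \<omega>) T ! j)))
      = (LINT \<omega>|M. real (card {i \<in> {..<n}. \<omega> \<in> V i}))"
    by (intro Bochner_Integration.integral_cong refl card)
  also have "\<dots> = real n * p"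
    by (rule expectation_card_events [OF V prob])
  finally show "(LINT \<omega>|M. real (card (shards n (\<lambda>i. U i \<omega>) T ! j))) = real n / 2 ^ k"
    by (simp add: p_def)
  have "(\<integral>\<^sup>+ \<omega>. ennreal ((real (card (shards n (\<lambda>i. U i \<omega>) T ! j)))\<^sup>2) \<partial>M)
      = (\<integral>\<^sup>+ \<omega>. ennreal ((real (card {i \<in> {..<n}. \<omega> \<in> V i}))\<^sup>2) \<partial>M)"
    by (intro nn_integral_cong) (simp only: card)
  also have "\<dots> = ennreal (expectation (\<lambda>\<omega>. (real (card {i \<in> {..<n}. \<omega> \<in> V i}))\<^sup>2))"
    by (intro nn_integral_eq_integral integrable_card_events_square [OF V prob]) auto
  also have "\<dots> \<le> ennreal (real n * p + (real n * p)\<^sup>2)"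
    by (intro ennreal_leI expectation_card_events_square_le [OF V prob pair])
  finally show "(\<integral>\<^sup>+ \<omega>. ennreal ((real (card (shards n (\<lambda>i. U i \<omega>) T ! j)))\<^sup>2) \<partial>M)
         \<le> ennreal (real n / 2 ^ k + (real n / 2 ^ k)\<^sup>2)"
    by (simp add: p_def)
qed

section \<open>Expected worst-case cost under a uniform auxiliary variable\<close>

context linear_cost_model
begin

text \<open>The factor 28 is twice 14, since the variance part and the squared mean of the shard
  sizes each contribute at most \<open>m\<^sup>2 * n\<^sup>2 / 2 ^ k\<close>.\<close>

lemma expected_sbt_worst_case_le:
  fixes x :: "nat \<Rightarrow> 'x"
  assumes aux: "uniform_aux M n U" and eq: "equal_cells k T"
  shows "(\<integral>\<^sup>+ \<omega>. sbt_worst_case cm n (\<lambda>i. U i \<omega>) x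
            (\<lambda>(T', Bs). T' = T \<and> (\<forall>B \<in> set Bs. length B = m)) \<partial>M)
     \<le> ennreal (28 * D * ((real n)\<^sup>2 + (real m)\<^sup>2 * (real n)\<^sup>2 / 2 ^ k))"
proof -
  interpret prob_space M using aux by (simp add: uniform_aux_def)
  let ?W = "\<lambda>\<omega>. sbt_worst_case cm n (\<lambda>i. U i \<omega>) x
            (\<lambda>(T', Bs). T' = T \<and> (\<forall>B \<in> set Bs. length B = m))"
  let ?c = "\<lambda>j \<omega>. (real (card (shards n (\<lambda>i. U i \<omega>) T ! j)))\<^sup>2"
  let ?p = "real n / 2 ^ k"
  show ?thesis
  proof (cases "size1 T \<le> n")
    \<comment> \<open>With more leaves than samples no admissible state has sharding tree
      \<open>T\<close>, so the supremum is over the empty set, which is 0 in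
      \<open>ennreal\<close>.\<close>
    case False
    have "?W \<omega> = 0" for \<omega>
    proof -
      have "?W \<omega> \<le> ennreal (14 * D * 0)"
        using False by (intro sbt_worst_case_le) (auto dest: sbt_state_size1)
      then show ?thesis by simp
    qed
    then show ?thesis by simp
  next
    case True
    have k: "height T = k" using eq by (simp add: equal_cells_def)
    have "real (size1 T) \<le> real (2 ^ k)" using size1_height [of T] unfolding k by (rule of_nat_mono)
    then have L: "real (size1 T) \<le> 2 ^ k" by (simp only: of_nat_power of_nat_numeral)
    have "?W \<omega> \<le> ennreal (14 * D * ((real n)\<^sup>2 + (\<Sum>j<size1 T. (real m)\<^sup>2 * ?c j \<omega>)))" for \<omega>
      by (intro sbt_worst_case_le) (auto simp: size_bound_def sbt_state_def intro!: sum_mono)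
    also have "ennreal (14 * D * ((real n)\<^sup>2 + (\<Sum>j<size1 T. (real m)\<^sup>2 * ?c j \<omega>)))
        = ennreal (14 * D * (real n)\<^sup>2) + (\<Sum>j<size1 T. ennreal (14 * D * (real m)\<^sup>2) * ennreal (?c j \<omega>))"
      for \<omega>
      using D_pos
      by (simp add: distrib_left sum_distrib_left mult.assoc ennreal_plus sum_nonneg
          flip: ennreal_mult sum_ennreal)
    \<comment> \<open>Monotonicity of \<open>nn_integral\<close> holds for arbitrary functions, so
      measurability is established for the bounding sum and not for the worst case itself.\<close>
    finally have "(\<integral>\<^sup>+ \<omega>. ?W \<omega> \<partial>M) \<le> (\<integral>\<^sup>+ \<omega>. ennreal (14 * D * (real n)\<^sup>2)
        + (\<Sum>j<size1 T. ennreal (14 * D * (real m)\<^sup>2) * ennreal (?c j \<omega>)) \<partial>M)"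
      by (intro nn_integral_mono)
    also have "\<dots> = ennreal (14 * D * (real n)\<^sup>2)
        + (\<Sum>j<size1 T. ennreal (14 * D * (real m)\<^sup>2) * (\<integral>\<^sup>+ \<omega>. ennreal (?c j \<omega>) \<partial>M))"
    proof -
      have meas: "(\<lambda>\<omega>. ennreal (?c j \<omega>)) \<in> borel_measurable M" if "j < size1 T" for j
        using borel_measurable_integrable [OF integrable_shard [OF aux eq that]] by measurable
      have "(\<integral>\<^sup>+ \<omega>. (\<Sum>j<size1 T. ennreal (14 * D * (real m)\<^sup>2) * ennreal (?c j \<omega>)) \<partial>M)
          = (\<Sum>j<size1 T. \<integral>\<^sup>+ \<omega>. ennreal (14 * D * (real m)\<^sup>2) * ennreal (?c j \<omega>) \<partial>M)"
        using meas by (intro nn_integral_sum) auto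
      also have "\<dots> = (\<Sum>j<size1 T. ennreal (14 * D * (real m)\<^sup>2) * (\<integral>\<^sup>+ \<omega>. ennreal (?c j \<omega>) \<partial>M))"
        using meas by (intro sum.cong refl nn_integral_cmult) auto
      finally show ?thesis
        using meas by (subst nn_integral_add) (auto simp: emeasure_space_1 intro!: borel_measurable_sum)
    qed
    also have "\<dots> \<le> ennreal (14 * D * (real n)\<^sup>2)
        + (\<Sum>j<size1 T. ennreal (14 * D * (real m)\<^sup>2) * ennreal (?p + ?p\<^sup>2))"
      by (intro add_left_mono sum_mono mult_left_mono nn_integral_shard_square_le [OF aux eq]) auto
    also have "\<dots> = ennreal (14 * D * ((real n)\<^sup>2 + (real m)\<^sup>2 * (real (size1 T) * ?p + real (size1 T) * ?p\<^sup>2)))"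
      using D_pos by (simp add: algebra_simps ennreal_plus ennreal_of_nat_eq_real_of_nat flip: ennreal_mult)
    also have "\<dots> \<le> ennreal (28 * D * ((real n)\<^sup>2 + (real m)\<^sup>2 * (real n)\<^sup>2 / 2 ^ k))"
    proof (rule ennreal_leI)
      \<comment> \<open>The two bounds on the number of leaves serve different terms: at most
        \<open>n\<close> leaves for the variance part, at most \<open>2 ^ k\<close> for the squared
        mean. Both terms end up below \<open>n * ?p\<close>.\<close>
      have "real (size1 T) * ?p \<le> real n * ?p"
        using True by (intro mult_right_mono) auto
      moreover have "real (size1 T) * ?p\<^sup>2 \<le> 2 ^ k * ?p\<^sup>2"
        using L by (intro mult_right_mono) auto
      moreover have "2 ^ k * ?p\<^sup>2 = real n * ?p"
      proof -
        have "q * (b / q)\<^sup>2 = b * (b / q)" if "q > 0" for b q :: real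
          using that by (simp add: power2_eq_square)
        then show ?thesis by simp
      qed
      ultimately have "real (size1 T) * ?p + real (size1 T) * ?p\<^sup>2 \<le> 2 * (real n * ?p)" by linarith
      then have "(real m)\<^sup>2 * (real (size1 T) * ?p + real (size1 T) * ?p\<^sup>2) \<le> (real m)\<^sup>2 * (2 * (real n * ?p))"
        by (intro mult_left_mono) auto
      also have "\<dots> = 2 * ((real m)\<^sup>2 * (real n)\<^sup>2 / 2 ^ k)" by (simp add: power2_eq_square)
      finally have "(real n)\<^sup>2 + (real m)\<^sup>2 * (real (size1 T) * ?p + real (size1 T) * ?p\<^sup>2)
          \<le> 2 * ((real n)\<^sup>2 + (real m)\<^sup>2 * (real n)\<^sup>2 / 2 ^ k)"
        using zero_le_power2 [of "real n"] unfolding distrib_left [of 2] by linarith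
      from mult_left_mono [OF this, of "14 * D"] D_pos
      show "14 * D * ((real n)\<^sup>2 + (real m)\<^sup>2 * (real (size1 T) * ?p + real (size1 T) * ?p\<^sup>2))
          \<le> 28 * D * ((real n)\<^sup>2 + (real m)\<^sup>2 * (real n)\<^sup>2 / 2 ^ k)"
        by simp
    qed
    finally show ?thesis .
  qed
qed

end

section \<open>Assembling all claims with one constant\<close>

theorem proposition14:
  fixes cm :: cost_model
  assumes move: "(\<lambda>a. real (move_cost cm a)) \<in> O(\<lambda>a. real a)"
    and lik: "(\<lambda>N. real (lik_cost cm N)) \<in> O(\<lambda>N. real N)"
    and prior: "(\<lambda>a. real (prior_cost cm a)) \<in> O(\<lambda>a. real a)"
  shows "\<exists>C > 0.
    (\<forall>(n::nat) (u :: nat \<Rightarrow> real) (x :: nat \<Rightarrow> 'x) (k::nat) (m :: nat \<Rightarrow> nat) (N :: nat \<Rightarrow> real).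
       (\<forall>i < n. u i \<in> {0..1}) \<longrightarrow>
       sbt_worst_case cm n u x (has_sizes n u k m N)
         \<le> ennreal (C * ((real n)\<^sup>2 + (\<Sum>j < 2 ^ k. (real (m j))\<^sup>2 * (N j)\<^sup>2)))) \<and>
    (\<forall>(n::nat) (u :: nat \<Rightarrow> real) (x :: nat \<Rightarrow> 'x) (k::nat) (m::nat).
       (\<forall>i < n. u i \<in> {0..1}) \<longrightarrow>
       sbt_worst_case cm n u x (has_sizes n u k (\<lambda>_. m) (\<lambda>_. real n / 2 ^ k))
         \<le> ennreal (C * ((real n)\<^sup>2 + (real m)\<^sup>2 * (real n)\<^sup>2 / 2 ^ k))) \<and>
    (\<forall>(M :: 'w measure) (n::nat) U (k::nat) T.
       uniform_aux M n U \<and> equal_cells k T \<longrightarrow>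
       (\<forall>j < size1 T.
          integrable M (\<lambda>\<omega>. real (card (shards n (\<lambda>i. U i \<omega>) T ! j))) \<and>
          (LINT \<omega>|M. real (card (shards n (\<lambda>i. U i \<omega>) T ! j))) = real n / 2 ^ k) \<and>
       (\<forall>(x :: nat \<Rightarrow> 'x) (m::nat).
          (\<integral>\<^sup>+ \<omega>. sbt_worst_case cm n (\<lambda>i. U i \<omega>) x
                   (\<lambda>(T', Bs). T' = T \<and> (\<forall>B \<in> set Bs. length B = m)) \<partial>M)
            \<le> ennreal (C * ((real n)\<^sup>2 + (real m)\<^sup>2 * (real n)\<^sup>2 / 2 ^ k)))) \<and>
    (\<forall>n m :: nat.
       (\<lambda>k::nat. (real n)\<^sup>2 + (real m)\<^sup>2 * (real n)\<^sup>2 / 2 ^ k) \<longlonglongrightarrow> (real n)\<^sup>2) \<and>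
    (\<forall>m::nat. \<forall>\<^sub>F k in sequentially.
       (\<forall>(n::nat) (u :: nat \<Rightarrow> real) (x :: nat \<Rightarrow> 'x).
          (\<forall>i < n. u i \<in> {0..1}) \<longrightarrow>
          sbt_worst_case cm n u x (has_sizes n u k (\<lambda>_. m) (\<lambda>_. real n / 2 ^ k))
            \<le> ennreal (C * (real n)\<^sup>2)) \<and>
       (\<forall>(M :: 'w measure) (n::nat) U T (x :: nat \<Rightarrow> 'x).
          uniform_aux M n U \<and> equal_cells k T \<longrightarrow>
          (\<integral>\<^sup>+ \<omega>. sbt_worst_case cm n (\<lambda>i. U i \<omega>) x
                   (\<lambda>(T', Bs). T' = T \<and> (\<forall>B \<in> set Bs. length B = m)) \<partial>M)
            \<le> ennreal (C * (real n)\<^sup>2)))"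
proof -
  obtain D1 where D1: "D1 > 0" "\<And>a. 1 \<le> a \<Longrightarrow> real (move_cost cm a) \<le> D1 * real a"
    using bigo_linear_bound [OF move] by blast
  obtain D2 where D2: "D2 > 0" "\<And>a. 1 \<le> a \<Longrightarrow> real (lik_cost cm a) \<le> D2 * real a"
    using bigo_linear_bound [OF lik] by blast
  obtain D3 where D3: "D3 > 0" "\<And>a. 1 \<le> a \<Longrightarrow> real (prior_cost cm a) \<le> D3 * real a"
    using bigo_linear_bound [OF prior] by blast
  define D where "D = D1 + D2 + D3"
  have D_ge: "D1 * real a \<le> D * real a" "D2 * real a \<le> D * real a" "D3 * real a \<le> D * real a" for a
    using D1 D2 D3 by (auto simp: D_def intro!: mult_right_mono)
  interpret linear_cost_model cm D
  proof
    show "D > 0" using D1(1) D2(1) D3(1) by (simp add: D_def)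
    fix a :: nat
    assume "1 \<le> a"
    then show "real (move_cost cm a) \<le> D * real a" "real (lik_cost cm a) \<le> D * real a"
      "real (prior_cost cm a) \<le> D * real a"
      using D1(2) D2(2) D3(2) D_ge order_trans by blast+
  qed
  let ?S = "\<lambda>n m k. (real n)\<^sup>2 + (real m)\<^sup>2 * (real n)\<^sup>2 / 2 ^ k"
  \<comment> \<open>The final constant 56 is twice 28: the expected bound brings 28, and replacing
    \<open>?S n m k\<close> by \<open>2 * n\<^sup>2\<close> for large \<open>k\<close> brings
    another 2.\<close>
  have mono: "a \<le> ennreal (56 * D * b)" if "a \<le> ennreal (c * D * b')" "c * b' \<le> 56 * b" for a b b' c
    using that(1)
  proof (rule order_trans)
    show "ennreal (c * D * b') \<le> ennreal (56 * D * b)"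
      using mult_left_mono [OF that(2), of D] D_pos by (intro ennreal_leI) (simp add: algebra_simps)
  qed
  have S_nonneg: "0 \<le> ?S n m k" for n m k by simp
  have general: "sbt_worst_case cm n u x (has_sizes n u k m N)
      \<le> ennreal (56 * D * ((real n)\<^sup>2 + (\<Sum>j<2 ^ k. (real (m j))\<^sup>2 * (N j)\<^sup>2)))"
    for n u and x :: "nat \<Rightarrow> 'x" and k m N
    by (rule mono [OF sbt_worst_case_has_sizes_le]) (simp add: sum_nonneg)
  \<comment> \<open>The free \<open>b\<close> lets one fact serve two claims:
    \<open>b = ?S n m k\<close> gives the bound for every \<open>k\<close>, and
    \<open>b = n\<^sup>2\<close> the one for large \<open>k\<close>.\<close>
  have equal: "sbt_worst_case cm n u x (has_sizes n u k (\<lambda>_. m) (\<lambda>_. real n / 2 ^ k))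
      \<le> ennreal (56 * D * b)" if "?S n m k \<le> 2 * b"
    for n u and x :: "nat \<Rightarrow> 'x" and k m b
  proof (rule mono [OF sbt_worst_case_equal_sizes_le])
    have "14 * v \<le> 56 * b" if "0 \<le> v" "v \<le> 2 * b" for v
      using that by linarith
    then show "14 * ?S n m k \<le> 56 * b" using S_nonneg that by blast
  qed
  have expected: "(\<integral>\<^sup>+ \<omega>. sbt_worst_case cm n (\<lambda>i. U i \<omega>) x
            (\<lambda>(T', Bs). T' = T \<and> (\<forall>B \<in> set Bs. length B = m)) \<partial>M)
      \<le> ennreal (56 * D * b)" if "uniform_aux M n U" "equal_cells k T" "?S n m k \<le> 2 * b"
    for M :: "'w measure" and n U and x :: "nat \<Rightarrow> 'x" and k m T b
  proof (rule mono [OF expected_sbt_worst_case_le [OF that(1,2)]])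
    have "28 * v \<le> 56 * b" if "v \<le> 2 * b" for v
      using that by linarith
    then show "28 * ?S n m k \<le> 56 * b" using that(3) by blast
  qed
  have self: "?S n m k \<le> 2 * ?S n m k" for n m k
  proof -
    have "v \<le> 2 * v" if "0 \<le> v" for v :: real
      using that by linarith
    then show ?thesis using S_nonneg by blast
  qed
  have lim: "(\<lambda>k. ?S n m k) \<longlonglongrightarrow> (real n)\<^sup>2" for n m
    by real_asymp
  \<comment> \<open>The threshold \<open>m\<^sup>2 \<le> 2 ^ k\<close> depends on \<open>m\<close>
    alone, so a single \<open>k\<close> works for all \<open>n\<close> at once.\<close>
  have "\<forall>\<^sub>F k in sequentially. \<forall>n. ?S n m k \<le> 2 * (real n)\<^sup>2" for m
  proof -
    have "\<forall>\<^sub>F k in sequentially. (real m)\<^sup>2 \<le> 2 ^ k" by real_asymp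
    then show ?thesis
    proof eventually_elim
      case (elim k)
      have "(real m)\<^sup>2 * (real n)\<^sup>2 / 2 ^ k \<le> (real n)\<^sup>2" for n
        using mult_right_mono [OF elim, of "(real n)\<^sup>2"] by (simp add: divide_le_eq mult.commute)
      then show ?case by (simp add: add_mono)
    qed
  qed
  then have absorbed: "\<forall>\<^sub>F k in sequentially.
       (\<forall>(n::nat) (u :: nat \<Rightarrow> real) (x :: nat \<Rightarrow> 'x).
          (\<forall>i < n. u i \<in> {0..1}) \<longrightarrow>
          sbt_worst_case cm n u x (has_sizes n u k (\<lambda>_. m) (\<lambda>_. real n / 2 ^ k))
            \<le> ennreal (56 * D * (real n)\<^sup>2)) \<and>
       (\<forall>(M :: 'w measure) (n::nat) U T (x :: nat \<Rightarrow> 'x).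
          uniform_aux M n U \<and> equal_cells k T \<longrightarrow>
          (\<integral>\<^sup>+ \<omega>. sbt_worst_case cm n (\<lambda>i. U i \<omega>) x
                   (\<lambda>(T', Bs). T' = T \<and> (\<forall>B \<in> set Bs. length B = m)) \<partial>M)
            \<le> ennreal (56 * D * (real n)\<^sup>2))" for m
    by (rule eventually_mono) (blast intro: equal expected)
  show ?thesis
  proof (intro exI [of _ "56 * D"] conjI allI impI)
    show "0 < 56 * D" using D_pos by simp
  qed (erule conjE | rule general lim absorbed | rule equal, rule self
      | rule integrable_shard expectation_shard, assumption, assumption, assumption
      | rule expected, assumption, assumption, rule self)+
qed

end
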